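(* Suppose the general linear time discretization (GLTD) with coefficient matrices $\mathbf D_{11}\in\mathbb R^{s\times s}$, $\mathbf D_{12}\in\mathbb R^{s\times r}$, $\mathbf D_{21}\in\mathbb R^{r\times s}$, $\mathbf D_{22}\in\mathbb R^{r\times r}$ is algebraically stable with symmetric positive definite matrix $\mathbf G=(g_{ij})\in\mathbb R^{r\times r}$. Then the semi-discrete SAV-GL scheme described in the context satisfies $$\frac12\left(\mathcal L\mathbf u^{[n+1]},\mathbf u^{[n+1]}\right)_{\mathbf G}+\left\|\mathbf z^{[n+1]}\right\|_{\mathbf G}^2\le \frac12\left(\mathcal L\mathbf u^{[n]},\mathbf u^{[n]}\right)_{\mathbf G}+\left\|\mathbf z^{[n]}\right\|_{\mathbf G}^2 ,$$ where $\mathbf u^{[n]}=(u_1^{[n]},\dots,u_r^{[n]})^T$ and $\mathbf z^{[n]}=(z_1^{[n]},\dots,z_r^{[n]})^T$, and where $$(\mathcal L\mathbf\Phi,\mathbf\Psi)_{\mathbf G}:=\sum_{i,j=1}^r g_{ij}(\mathcal L\phi_i,\psi_j),\qquad \|\boldsymbol\sigma\|_{\mathbf G}:=\Big(\sum_{i,j=1}^r g_{ij}\sigma_i\sigma_j\Big)^{1/2}$$ for $\mathbf\Phi=(\phi_1,\dots,\phi_r)^T$, $\mathbf\Psi=(\psi_1,\dots,\psi_r)^T$ with components in $L^2(\Omega)$ (and $\phi_i$ in the domain of $\mathcal L$) and $\boldsymbol\sigma\in\mathbb R^r$.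
   Context: Gradient flow. $\Omega$ is a bounded open domain, $(\cdot,\cdot)$ and $\|\cdot\|$ are the $L^2(\Omega)$ inner product and norm. The free energy is $\mathcal F(u)=\frac12(\mathcal Lu,u)+\mathcal F_1(u)$, $\mathcal F_1(u)=\int_\Omega F(u)\,dx$, where $\mathcal L$ is a symmetric, non-negative, linear, self-adjoint elliptic operator and $\mathcal F_1$ is bounded from below; $C_0$ is a constant with $\mathcal F_1(u)+C_0>0$. The gradient flow is $\partial_t u=\mathcal G\mu$, $\mu=\delta\mathcal F/\delta u$, with $\mathcal G$ a symmetric non-positive linear operator ($(v,\mathcal Gv)\le 0$). Boundary conditions are periodic, or such that integration by parts introduces no boundary terms; thus $(\mathcal Lv,w)=(v,\mathcal Lw)$ for all functions considered. With the scalar auxiliary variable (SAV) $z(t)=\sqrt{\mathcal F_1(u)+C_0}$ and $W(v):=\frac{1}{\sqrt{\mathcal F_1(v)+C_0}}\frac{\delta\mathcal F_1}{\delta u}(v)$, the flow is rewritten as $\partial_tu=\mathcal G\mu$, $\mu=\mathcal Lu+zW(u)$, $\frac{dz}{dt}=\frac12(W(u),\partial_tu)$. GLTD. For $u'=f(u)$ and stepsize $\tau>0$, a GLTD is $U_{n,i}=\tau\sum_{j=1}^sd^{11}_{ij}f(U_{n,j})+\sum_{j=1}^rd^{12}_{ij}u_j^{[n]}$ ($1\le i\le s$), $u_i^{[n+1]}=\tau\sum_{j=1}^sd^{21}_{ij}f(U_{n,j})+\sum_{j=1}^rd^{22}_{ij}u_j^{[n]}$ ($1\le i\le r$), with $\mathbf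 D_{\imath\jmath}=(d_{ij}^{\imath\jmath})$ real matrices. Algebraic stability. The GLTD is algebraically stable if there exist a symmetric positive definite $\mathbf G\in\mathbb R^{r\times r}$ and a non-negative definite diagonal $\mathbf H\in\mathbb R^{s\times s}$ such that the matrix $$\mathbf M=\begin{bmatrix}\mathbf G-\mathbf D_{22}^T\mathbf G\mathbf D_{22}&\mathbf D_{12}^T\mathbf H-\mathbf D_{22}^T\mathbf G\mathbf D_{21}\\ \mathbf H\mathbf D_{12}-\mathbf D_{21}^T\mathbf G\mathbf D_{22}&\mathbf D_{11}^T\mathbf H+\mathbf H\mathbf D_{11}-\mathbf D_{21}^T\mathbf G\mathbf D_{21}\end{bmatrix}$$ is non-negative definite. Semi-discrete SAV-GL scheme. Given functions $u_i^{[n]}$ and real numbers $z_i^{[n]}$ ($1\le i\le r$), and explicitly known functions $\bar U_{n,i}$ (approximations, obtained by extrapolation, of $u(\cdot,t_n+c_i\tau)$), the quantities $U_{n,i},Z_{n,i}$ ($1\le i\le s$) solve $$U_{n,i}=\tau\sum_{j=1}^sd^{11}_{ij}\dot U_{n,j}+\sum_{j=1}^rd^{12}_{ij}u_j^{[n]},\quad Z_{n,i}=\tau\sum_{j=1}^sd^{11}_{ij}\dot Z_{n,j}+\sum_{j=1}^rd^{12}_{ij}z_j^{[n]},$$ $$\dot U_{n,i}=\mathcal G\mu_{n,i},\quad \mu_{n,i}=\mathcal LU_{n,i}+Z_{n,i}W(\bar U_{n,i}),\quad \dot Z_{n,i}=\tfrac12\big(W(\bar U_{n,i}),\dot U_{n,i}\big),$$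 and, for $1\le i\le r$, $$u_i^{[n+1]}=\tau\sum_{j=1}^sd^{21}_{ij}\dot U_{n,j}+\sum_{j=1}^rd^{22}_{ij}u_j^{[n]},\quad z_i^{[n+1]}=\tau\sum_{j=1}^sd^{21}_{ij}\dot Z_{n,j}+\sum_{j=1}^rd^{22}_{ij}z_j^{[n]}.$$ All functions involved are assumed regular enough for the expressions above to make sense, and to satisfy the boundary conditions. *)

theory Defs
  imports "HOL-Analysis.Analysis"
begin

section \<open>The space \<open>L\<^sup>2(\<Omega>)\<close>\<close>

text \<open>
  Elements of \<open>L\<^sup>2(\<Omega>)\<close> are represented by functions on the whole space of which only
  the values on \<open>\<Omega>\<close>, up to Lebesgue null sets, matter; \<open>eq_on_ae\<close> is equality in \<open>L\<^sup>2(\<Omega>)\<close>.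
\<close>

definition domain_set :: "'a::euclidean_space set \<Rightarrow> bool" where
  "domain_set \<Omega> \<longleftrightarrow> \<Omega> \<noteq> {} \<and> open \<Omega> \<and> connected \<Omega>"

definition L2 :: "'a::euclidean_space set \<Rightarrow> ('a \<Rightarrow> real) set" where
  "L2 \<Omega> = {f. f \<in> borel_measurable (lebesgue_on \<Omega>) \<and>
              integrable (lebesgue_on \<Omega>) (\<lambda>x. (f x)\<^sup>2)}"

definition L2_inner :: "'a::euclidean_space set \<Rightarrow> ('a \<Rightarrow> real) \<Rightarrow> ('a \<Rightarrow> real) \<Rightarrow> real" where
  "L2_inner \<Omega> f g = (LINT x|lebesgue_on \<Omega>. f x * g x)"

definition eq_on_ae :: "'a::euclidean_space set \<Rightarrow> ('a \<Rightarrow> real) \<Rightarrow> ('a \<Rightarrow> real) \<Rightarrow> bool" where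
  "eq_on_ae \<Omega> f g \<longleftrightarrow> (AE x in lebesgue_on \<Omega>. f x = g x)"


section \<open>Linear operators in \<open>L\<^sup>2(\<Omega>)\<close>\<close>

definition L2_subspace :: "'a::euclidean_space set \<Rightarrow> ('a \<Rightarrow> real) set \<Rightarrow> bool" where
  "L2_subspace \<Omega> V \<longleftrightarrow>
     V \<subseteq> L2 \<Omega> \<and> (\<lambda>x. 0) \<in> V \<and>
     (\<forall>v\<in>V. \<forall>w\<in>V. (\<lambda>x. v x + w x) \<in> V) \<and>
     (\<forall>c. \<forall>v\<in>V. (\<lambda>x. c * v x) \<in> V)"

text \<open>
  A (possibly unbounded) linear operator in \<open>L\<^sup>2(\<Omega>)\<close> with domain \<open>V\<close>. Boundary conditions
  and regularity requirements are encoded in the choice of \<open>V\<close>.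
\<close>

definition linear_operator ::
    "'a::euclidean_space set \<Rightarrow> ('a \<Rightarrow> real) set \<Rightarrow> (('a \<Rightarrow> real) \<Rightarrow> ('a \<Rightarrow> real)) \<Rightarrow> bool" where
  "linear_operator \<Omega> V A \<longleftrightarrow>
     L2_subspace \<Omega> V \<and> A ` V \<subseteq> L2 \<Omega> \<and>
     (\<forall>v\<in>V. \<forall>w\<in>V. eq_on_ae \<Omega> v w \<longrightarrow> eq_on_ae \<Omega> (A v) (A w)) \<and>
     (\<forall>v\<in>V. \<forall>w\<in>V. eq_on_ae \<Omega> (A (\<lambda>x. v x + w x)) (\<lambda>x. A v x + A w x)) \<and>
     (\<forall>c. \<forall>v\<in>V. eq_on_ae \<Omega> (A (\<lambda>x. c * v x)) (\<lambda>x. c * A v x))"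

text \<open>
  Symmetry on the class \<open>V\<close> of functions considered, i.e. integration by parts without
  boundary terms. Every self-adjoint operator satisfies it on its domain and on every
  subspace of its domain.
\<close>

definition symmetric_operator ::
    "'a::euclidean_space set \<Rightarrow> ('a \<Rightarrow> real) set \<Rightarrow> (('a \<Rightarrow> real) \<Rightarrow> ('a \<Rightarrow> real)) \<Rightarrow> bool" where
  "symmetric_operator \<Omega> V A \<longleftrightarrow>
     (\<forall>v\<in>V. \<forall>w\<in>V. L2_inner \<Omega> (A v) w = L2_inner \<Omega> v (A w))"

definition nonneg_operator ::
    "'a::euclidean_space set \<Rightarrow> ('a \<Rightarrow> real) set \<Rightarrow> (('a \<Rightarrow> real) \<Rightarrow> ('a \<Rightarrow> real)) \<Rightarrow> bool" where
  "nonneg_operator \<Omega> V A \<longleftrightarrow> (\<forall>v\<in>V. 0 \<le> L2_inner \<Omega> (A v) v)"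

definition nonpos_operator ::
    "'a::euclidean_space set \<Rightarrow> ('a \<Rightarrow> real) set \<Rightarrow> (('a \<Rightarrow> real) \<Rightarrow> ('a \<Rightarrow> real)) \<Rightarrow> bool" where
  "nonpos_operator \<Omega> V A \<longleftrightarrow> (\<forall>v\<in>V. L2_inner \<Omega> v (A v) \<le> 0)"


section \<open>The nonlinear part of the free energy\<close>

definition F1 :: "'a::euclidean_space set \<Rightarrow> (real \<Rightarrow> real) \<Rightarrow> ('a \<Rightarrow> real) \<Rightarrow> real" where
  "F1 \<Omega> F u = (LINT x|lebesgue_on \<Omega>. F (u x))"

text \<open>
  \<open>g\<close> is a variational derivative of \<open>\<Phi>\<close> at \<open>v\<close>, the variations being taken in \<open>V\<close>.
\<close>

definition has_variational_derivative ::
    "'a::euclidean_space set \<Rightarrow> ('a \<Rightarrow> real) set \<Rightarrow> (('a \<Rightarrow> real) \<Rightarrow> real) \<Rightarrow>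
     ('a \<Rightarrow> real) \<Rightarrow> ('a \<Rightarrow> real) \<Rightarrow> bool" where
  "has_variational_derivative \<Omega> V \<Phi> v g \<longleftrightarrow>
     g \<in> L2 \<Omega> \<and>
     (\<forall>\<phi>\<in>V. ((\<lambda>\<epsilon>. \<Phi> (\<lambda>x. v x + \<epsilon> * \<phi> x)) has_real_derivative L2_inner \<Omega> g \<phi>) (at 0))"

text \<open>
  \<open>dF1 v\<close> stands for the variational derivative of \<open>F1 \<Omega> F\<close> at \<open>v\<close>. The integrability
  condition is needed because \<open>LINT\<close> is 0 for non-integrable functions.
\<close>

definition SAV_energy ::
    "'a::euclidean_space set \<Rightarrow> ('a \<Rightarrow> real) set \<Rightarrow> (real \<Rightarrow> real) \<Rightarrow>
     (('a \<Rightarrow> real) \<Rightarrow> ('a \<Rightarrow> real)) \<Rightarrow> real \<Rightarrow> bool" where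
  "SAV_energy \<Omega> V F dF1 C0 \<longleftrightarrow>
     (\<forall>v\<in>V. integrable (lebesgue_on \<Omega>) (\<lambda>x. F (v x))) \<and>
     bdd_below (F1 \<Omega> F ` V) \<and>
     (\<forall>v\<in>V. F1 \<Omega> F v + C0 > 0) \<and>
     (\<forall>v\<in>V. has_variational_derivative \<Omega> V (F1 \<Omega> F) v (dF1 v))"

definition SAV_W ::
    "'a::euclidean_space set \<Rightarrow> (real \<Rightarrow> real) \<Rightarrow> (('a \<Rightarrow> real) \<Rightarrow> ('a \<Rightarrow> real)) \<Rightarrow> real \<Rightarrow>
     ('a \<Rightarrow> real) \<Rightarrow> ('a \<Rightarrow> real)" where
  "SAV_W \<Omega> F dF1 C0 v = (\<lambda>x. 1 / sqrt (F1 \<Omega> F v + C0) * dF1 v x)"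


section \<open>General linear time discretizations\<close>

text \<open>
  \<open>s\<close> and \<open>r\<close> are the cardinalities of the index types \<open>'s\<close> and \<open>'r\<close>; \<open>real ^ 'n ^ 'm\<close> is
  the type of matrices with rows indexed by \<open>'m\<close> and columns indexed by \<open>'n\<close>.
  The argument \<open>K\<close> holds the stage derivatives \<open>f (U j)\<close>.
\<close>

definition GLTD_step ::
    "real ^ 's ^ 's \<Rightarrow> real ^ 'r ^ 's \<Rightarrow> real ^ 's ^ 'r \<Rightarrow> real ^ 'r ^ 'r \<Rightarrow> real \<Rightarrow>
     ('r \<Rightarrow> real) \<Rightarrow> ('s \<Rightarrow> real) \<Rightarrow> ('s \<Rightarrow> real) \<Rightarrow> ('r \<Rightarrow> real) \<Rightarrow> bool" where
  "GLTD_step D11 D12 D21 D22 \<tau> u U K u' \<longleftrightarrow>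
     (\<forall>i. U i = \<tau> * (\<Sum>j\<in>UNIV. D11 $ i $ j * K j) + (\<Sum>j\<in>UNIV. D12 $ i $ j * u j)) \<and>
     (\<forall>i. u' i = \<tau> * (\<Sum>j\<in>UNIV. D21 $ i $ j * K j) + (\<Sum>j\<in>UNIV. D22 $ i $ j * u j))"

definition nonneg_definite :: "real ^ 'n ^ 'n \<Rightarrow> bool" where
  "nonneg_definite A \<longleftrightarrow> (\<forall>x. 0 \<le> x \<bullet> (A *v x))"

definition sym_pos_definite :: "real ^ 'n ^ 'n \<Rightarrow> bool" where
  "sym_pos_definite A \<longleftrightarrow> transpose A = A \<and> (\<forall>x. x \<noteq> 0 \<longrightarrow> 0 < x \<bullet> (A *v x))"

definition diagonal_matrix :: "real ^ 'n ^ 'n \<Rightarrow> bool" where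
  "diagonal_matrix A \<longleftrightarrow> (\<forall>i j. i \<noteq> j \<longrightarrow> A $ i $ j = 0)"

definition block_matrix ::
    "real ^ 'r ^ 'r \<Rightarrow> real ^ 's ^ 'r \<Rightarrow> real ^ 'r ^ 's \<Rightarrow> real ^ 's ^ 's \<Rightarrow>
     real ^ ('r + 's) ^ ('r + 's)" where
  "block_matrix A B C D =
     (\<chi> k l. case k of
        Inl i \<Rightarrow> (case l of Inl j \<Rightarrow> A $ i $ j | Inr j \<Rightarrow> B $ i $ j)
      | Inr i \<Rightarrow> (case l of Inl j \<Rightarrow> C $ i $ j | Inr j \<Rightarrow> D $ i $ j))"

definition stability_matrix ::
    "real ^ 's ^ 's \<Rightarrow> real ^ 'r ^ 's \<Rightarrow> real ^ 's ^ 'r \<Rightarrow> real ^ 'r ^ 'r \<Rightarrow>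
     real ^ 'r ^ 'r \<Rightarrow> real ^ 's ^ 's \<Rightarrow> real ^ ('r + 's) ^ ('r + 's)" where
  "stability_matrix D11 D12 D21 D22 G H =
     block_matrix
       (G - transpose D22 ** G ** D22)
       (transpose D12 ** H - transpose D22 ** G ** D21)
       (H ** D12 - transpose D21 ** G ** D22)
       (transpose D11 ** H + H ** D11 - transpose D21 ** G ** D21)"

definition algebraically_stable_with ::
    "real ^ 's ^ 's \<Rightarrow> real ^ 'r ^ 's \<Rightarrow> real ^ 's ^ 'r \<Rightarrow> real ^ 'r ^ 'r \<Rightarrow>
     real ^ 'r ^ 'r \<Rightarrow> bool" where
  "algebraically_stable_with D11 D12 D21 D22 G \<longleftrightarrow>
     sym_pos_definite G \<and>
     (\<exists>H. diagonal_matrix H \<and> nonneg_definite H \<and>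
          nonneg_definite (stability_matrix D11 D12 D21 D22 G H))"


section \<open>The semi-discrete SAV-GL scheme\<close>

text \<open>
  One step from \<open>(u, z)\<close> to \<open>(u', z')\<close>, with extrapolated functions \<open>Ubar\<close>, stages \<open>U, Z\<close>,
  stage derivatives \<open>Udot, Zdot\<close> and chemical potentials \<open>\<mu>\<close>. \<open>V\<close> is the domain of \<open>\<L>\<close> and
  \<open>V\<^sub>G\<close> that of \<open>\<G>\<close>. The membership conditions express that all functions are regular
  enough and satisfy the boundary conditions; this includes \<open>Udot i \<in> V\<close>, since the symmetry
  of \<open>\<L>\<close> is also used for the stage derivatives.
\<close>

definition SAV_GL_step ::
    "'a::euclidean_space set \<Rightarrow>
     ('a \<Rightarrow> real) set \<Rightarrow> (('a \<Rightarrow> real) \<Rightarrow> ('a \<Rightarrow> real)) \<Rightarrow>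
     ('a \<Rightarrow> real) set \<Rightarrow> (('a \<Rightarrow> real) \<Rightarrow> ('a \<Rightarrow> real)) \<Rightarrow>
     (('a \<Rightarrow> real) \<Rightarrow> ('a \<Rightarrow> real)) \<Rightarrow>
     real ^ 's ^ 's \<Rightarrow> real ^ 'r ^ 's \<Rightarrow> real ^ 's ^ 'r \<Rightarrow> real ^ 'r ^ 'r \<Rightarrow> real \<Rightarrow>
     ('s \<Rightarrow> 'a \<Rightarrow> real) \<Rightarrow>
     ('r \<Rightarrow> 'a \<Rightarrow> real) \<Rightarrow> ('r \<Rightarrow> real) \<Rightarrow>
     ('s \<Rightarrow> 'a \<Rightarrow> real) \<Rightarrow> ('s \<Rightarrow> real) \<Rightarrow>
     ('s \<Rightarrow> 'a \<Rightarrow> real) \<Rightarrow> ('s \<Rightarrow> real) \<Rightarrow>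
     ('s \<Rightarrow> 'a \<Rightarrow> real) \<Rightarrow>
     ('r \<Rightarrow> 'a \<Rightarrow> real) \<Rightarrow> ('r \<Rightarrow> real) \<Rightarrow> bool" where
  "SAV_GL_step \<Omega> V \<L> V\<^sub>G \<G> W D11 D12 D21 D22 \<tau> Ubar u z U Z Udot Zdot \<mu> u' z' \<longleftrightarrow>
     (\<forall>i. Ubar i \<in> V \<and> U i \<in> V \<and> Udot i \<in> V \<and> \<mu> i \<in> V\<^sub>G) \<and>
     (\<forall>i. u i \<in> V \<and> u' i \<in> V) \<and>
     (AE x in lebesgue_on \<Omega>.
        GLTD_step D11 D12 D21 D22 \<tau> (\<lambda>i. u i x) (\<lambda>i. U i x) (\<lambda>i. Udot i x) (\<lambda>i. u' i x)) \<and>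
     GLTD_step D11 D12 D21 D22 \<tau> z Z Zdot z' \<and>
     (\<forall>i. eq_on_ae \<Omega> (Udot i) (\<G> (\<mu> i))) \<and>
     (\<forall>i. eq_on_ae \<Omega> (\<mu> i) (\<lambda>x. \<L> (U i) x + Z i * W (Ubar i) x)) \<and>
     (\<forall>i. Zdot i = 1 / 2 * L2_inner \<Omega> (W (Ubar i)) (Udot i))"

definition G_form ::
    "'a::euclidean_space set \<Rightarrow> (('a \<Rightarrow> real) \<Rightarrow> ('a \<Rightarrow> real)) \<Rightarrow> real ^ 'r ^ 'r \<Rightarrow>
     ('r \<Rightarrow> 'a \<Rightarrow> real) \<Rightarrow> ('r \<Rightarrow> 'a \<Rightarrow> real) \<Rightarrow> real" where
  "G_form \<Omega> \<L> G \<Phi> \<Psi> =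
     (\<Sum>i\<in>UNIV. \<Sum>j\<in>UNIV. G $ i $ j * L2_inner \<Omega> (\<L> (\<Phi> i)) (\<Psi> j))"

definition G_norm :: "real ^ 'r ^ 'r \<Rightarrow> ('r \<Rightarrow> real) \<Rightarrow> real" where
  "G_norm G \<sigma> = sqrt (\<Sum>i\<in>UNIV. \<Sum>j\<in>UNIV. G $ i $ j * \<sigma> i * \<sigma> j)"

end

theory Submission imports Defs begin

text \<open>
  For a scalar problem, collect the external input \<open>u\<close> and the scaled stage derivatives
  \<open>\<tau> K\<close> in one vector \<open>\<xi>\<close>. Multiplying out gives
  \<open>\<xi> \<bullet> M \<xi> = u \<bullet> G u - u' \<bullet> G u' + 2 \<tau> (\<Sum>i. h\<^sub>i U\<^sub>i K\<^sub>i)\<close>, where \<open>M\<close> is the stability matrix and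
  \<open>h \<ge> 0\<close> is the diagonal of \<open>H\<close>. Algebraic stability thus bounds the growth of the \<open>G\<close>-norm
  by the weighted pairing of the stages with their derivatives
  (\<open>algebraically_stable_scalar\<close>). This applies directly to the auxiliary variable \<open>z\<close>.

  For the functions \<open>u\<close>, products of numbers are replaced by the form \<open>(\<L> v, w)\<close>, which is
  symmetric and non-negative. Only finitely many functions occur in one step, and their Gram
  matrix is positive semidefinite, so the form on them agrees with the Euclidean inner
  product of suitable coordinate vectors (\<open>psd_gram_coordinates\<close>). A linear combination that
  vanishes in \<open>L\<^sup>2(\<Omega>)\<close> has norm zero, hence its coordinate vector vanishes: each coordinate
  performs a step of the scalar scheme. Adding up the scalar estimates over the coordinates
  gives the estimate for \<open>u\<close> (\<open>GLTD_energy_estimate\<close>).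

  Finally, half of the estimate for \<open>u\<close> is added to the one for \<open>z\<close>. In stage \<open>i\<close> the
  remainder, with \<open>K\<^sub>i\<close> the derivative of \<open>U\<^sub>i\<close>, is \<open>\<tau> h\<^sub>i\<close> times
  \<open>(\<L> U\<^sub>i, K\<^sub>i) + Z\<^sub>i (W(Ubar\<^sub>i), K\<^sub>i) = (\<mu>\<^sub>i, K\<^sub>i) = (\<mu>\<^sub>i, \<G> \<mu>\<^sub>i) \<le> 0\<close>
  (\<open>SAV_GL_dissipation\<close>). The factor \<open>1/2\<close> in the equation for the derivative of \<open>Z\<close> is what
  makes the two contributions combine to \<open>\<mu>\<^sub>i\<close>.
\<close>

section \<open>Gram coordinates of a semidefinite form\<close>

text \<open>
  A Cholesky factorisation, by induction on the index set. The row of \<open>b\<close> at a new index \<open>a\<close>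
  contributes the rank-one form given by \<open>e k = b a k / sqrt (b a a)\<close>; the difference vanishes
  in row \<open>a\<close>, and on the old indices it is the Schur complement, which is again semidefinite.
\<close>

lemma psd_gram_coordinates_on:
  fixes b :: "'k \<Rightarrow> 'k \<Rightarrow> real"
  assumes "finite S"
    and "\<And>k l. k \<in> S \<Longrightarrow> l \<in> S \<Longrightarrow> b k l = b l k"
    and "\<And>x. 0 \<le> (\<Sum>k\<in>S. \<Sum>l\<in>S. x k * x l * b k l)"
  shows "\<exists>(m::nat) c. \<forall>k\<in>S. \<forall>l\<in>S. b k l = (\<Sum>p<m. c p k * c p l)"
  using assms
proof (induction S arbitrary: b rule: finite_induct)
  case empty
  then show ?case by simp
next
  case (insert a S)
  note sym = insert.prems(1) and psd = insert.prems(2)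
  have expand: "(\<Sum>k\<in>insert a S. \<Sum>l\<in>insert a S. x k * x l * b k l)
      = x a * x a * b a a + 2 * x a * (\<Sum>k\<in>S. x k * b a k) + (\<Sum>k\<in>S. \<Sum>l\<in>S. x k * x l * b k l)"
    for x
  proof -
    have "(\<Sum>k\<in>S. x k * x a * b k a) = x a * (\<Sum>k\<in>S. x k * b a k)"
      unfolding sum_distrib_left by (rule sum.cong) (use sym in \<open>auto simp: mult_ac\<close>)
    moreover have "(\<Sum>l\<in>S. x a * x l * b a l) = x a * (\<Sum>k\<in>S. x k * b a k)"
      unfolding sum_distrib_left by (simp add: mult_ac)
    ultimately show ?thesis
      using insert.hyps by (simp add: sum.distrib algebra_simps)
  qed
  have quad: "0 \<le> t * t * b a a + 2 * t * (\<Sum>k\<in>S. x k * b a k) + (\<Sum>k\<in>S. \<Sum>l\<in>S. x k * x l * b k l)"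
    for t x
  proof -
    define y where "y = x(a := t)"
    have a: "y a = t" by (simp add: y_def)
    have eq: "y k = x k" if "k \<in> S" for k
      using that insert.hyps by (auto simp: y_def)
    have "0 \<le> y a * y a * b a a + 2 * y a * (\<Sum>k\<in>S. y k * b a k) + (\<Sum>k\<in>S. \<Sum>l\<in>S. y k * y l * b k l)"
      using psd[of y] unfolding expand .
    then show ?thesis by (simp add: a eq cong: sum.cong)
  qed
  have diag: "0 \<le> b a a"
    using quad[of 1 "\<lambda>_. 0"] by simp
  \<comment> \<open>if \<open>b a a = 0\<close>, then \<open>e = 0\<close> as \<open>x / 0 = 0\<close>, and semidefiniteness makes the row vanish too\<close>
  define e where "e k = b a k / sqrt (b a a)" for k
  have row: "b a k = e a * e k" if "k \<in> insert a S" for k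
  proof (cases "b a a = 0")
    case False
    then show ?thesis using diag by (simp add: e_def field_simps flip: real_sqrt_mult)
  next
    case True
    have "b a k = 0"
    proof (rule ccontr)
      assume nz: "b a k \<noteq> 0"
      with True that have kS: "k \<in> S" by auto
      \<comment> \<open>with weight \<open>t\<close> at \<open>a\<close> and \<open>1\<close> at \<open>k\<close> the form is affine in \<open>t\<close>, with value \<open>-1\<close> at \<open>?t\<close>\<close>
      let ?x = "\<lambda>j. if j = k then 1 else 0 :: real"
      let ?t = "- (b k k + 1) / (2 * b a k)"
      have 1: "(\<Sum>j\<in>S. ?x j * b a j) = b a k"
        using kS insert.hyps by (simp add: if_distrib[of "\<lambda>y. y * _"] cong: if_cong)
      have 2: "(\<Sum>j\<in>S. \<Sum>l\<in>S. ?x j * ?x l * b j l) = b k k"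
      proof -
        have "(\<Sum>j\<in>S. \<Sum>l\<in>S. ?x j * ?x l * b j l) = (\<Sum>j\<in>S. if j = k then b k k else 0)"
          using kS insert.hyps by (intro sum.cong refl) (auto simp: if_distrib[of "\<lambda>y. y * _"] cong: if_cong)
        then show ?thesis using kS insert.hyps by simp
      qed
      show False
        using quad[of ?t ?x] nz True unfolding 1 2 by (simp add: field_simps)
    qed
    then show ?thesis using True by (simp add: e_def)
  qed
  define b' where "b' k l = b k l - e k * e l" for k l
  have "\<exists>(m::nat) c. \<forall>k\<in>S. \<forall>l\<in>S. b' k l = (\<Sum>p<m. c p k * c p l)"
  proof (rule insert.IH)
    show "b' k l = b' l k" if "k \<in> S" "l \<in> S" for k l
      using sym that by (simp add: b'_def mult.commute)
    show "0 \<le> (\<Sum>k\<in>S. \<Sum>l\<in>S. x k * x l * b' k l)" for x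
    proof -
      let ?s = "\<Sum>k\<in>S. x k * e k"
      have s: "(\<Sum>k\<in>S. x k * b a k) = e a * ?s"
        unfolding sum_distrib_left by (rule sum.cong) (auto simp: row)
      have aa: "b a a = e a * e a" using row by simp
      have sq: "(\<Sum>k\<in>S. \<Sum>l\<in>S. x k * x l * b' k l) = (\<Sum>k\<in>S. \<Sum>l\<in>S. x k * x l * b k l) - ?s * ?s"
        by (simp add: b'_def algebra_simps sum_subtractf sum_product)
      show ?thesis
      proof (cases "e a = 0")
        case True
        then have "b a a = 0" using aa by simp
        then have "e k = 0" for k by (simp add: e_def)
        then show ?thesis using sq quad[of 0 x] by simp
      next
        case False
        \<comment> \<open>minimise the quadratic form over the coordinate belonging to \<open>a\<close>\<close>
        then show ?thesis using sq quad[of "- ?s / e a" x] unfolding s aa by (simp add: field_simps)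
      qed
    qed
  qed
  then obtain m c where c: "\<And>k l. k \<in> S \<Longrightarrow> l \<in> S \<Longrightarrow> b' k l = (\<Sum>p<m::nat. c p k * c p l)"
    by blast
  define d where "d p k = (if p = m then e k else if k = a then 0 else c p k)" for p k
  have "b k l = (\<Sum>p<Suc m. d p k * d p l)" if "k \<in> insert a S" "l \<in> insert a S" for k l
  proof -
    have "(\<Sum>p<Suc m. d p k * d p l)
        = (\<Sum>p<m. if k = a \<or> l = a then 0 else c p k * c p l) + e k * e l"
      by (simp add: d_def) (auto intro: sum.cong)
    also have "\<dots> = b k l"
    proof (cases "k = a \<or> l = a")
      case True
      have "b k l = e k * e l"
      proof (cases "k = a")
        case True
        then show ?thesis using row that by simp
      next
        case False
        then have "l = a" using True by simp
        then show ?thesis using row[of k] sym[of k a] that by simp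
      qed
      then show ?thesis using True by simp
    next
      case False
      then show ?thesis using that c[of k l] by (simp add: b'_def)
    qed
    finally show ?thesis by simp
  qed
  then show ?case by blast
qed

text \<open>
  The second property says that coordinates respect the null vectors of \<open>b\<close>: in coordinates
  the quadratic form is a sum of squares, so all of them vanish when the form does.
\<close>

lemma psd_gram_coordinates:
  fixes b :: "'k::finite \<Rightarrow> 'k \<Rightarrow> real"
  assumes "\<And>k l. b k l = b l k"
    and "\<And>x. 0 \<le> (\<Sum>k\<in>UNIV. \<Sum>l\<in>UNIV. x k * x l * b k l)"
  obtains m :: nat and c
  where "\<And>k l. b k l = (\<Sum>p<m. c p k * c p l)"
    and "\<And>x p. (\<Sum>k\<in>UNIV. \<Sum>l\<in>UNIV. x k * x l * b k l) = 0 \<Longrightarrow> p < m \<Longrightarrow> (\<Sum>k\<in>UNIV. x k * c p k) = 0"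
proof -
  obtain m c where c: "\<And>k l. b k l = (\<Sum>p<m::nat. c p k * c p l)"
    using psd_gram_coordinates_on[of UNIV b] assms by auto
  have "(\<Sum>k\<in>UNIV. x k * c p k) = 0"
    if "(\<Sum>k\<in>UNIV. \<Sum>l\<in>UNIV. x k * x l * b k l) = 0" "p < m" for x p
  proof -
    have "(\<Sum>k\<in>UNIV. \<Sum>l\<in>UNIV. x k * x l * b k l)
        = (\<Sum>k\<in>UNIV. \<Sum>l\<in>UNIV. \<Sum>p<m. (x k * c p k) * (x l * c p l))"
      by (simp add: c sum_distrib_left mult_ac)
    also have "\<dots> = (\<Sum>k\<in>UNIV. \<Sum>p<m. \<Sum>l\<in>UNIV. (x k * c p k) * (x l * c p l))"
      by (intro sum.cong refl sum.swap)
    also have "\<dots> = (\<Sum>p<m. \<Sum>k\<in>UNIV. \<Sum>l\<in>UNIV. (x k * c p k) * (x l * c p l))"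
      by (rule sum.swap)
    also have "\<dots> = (\<Sum>p<m. (\<Sum>k\<in>UNIV. x k * c p k)\<^sup>2)"
      by (simp add: sum_product power2_eq_square)
    finally show ?thesis
      using that by (simp add: sum_nonneg_eq_0_iff)
  qed
  with c that show ?thesis by blast
qed


section \<open>Algebraic stability for scalar problems\<close>

lemma sum_UNIV_Plus:
  fixes f :: "'a::finite + 'b::finite \<Rightarrow> real"
  shows "(\<Sum>k\<in>UNIV. f k) = (\<Sum>i\<in>UNIV. f (Inl i)) + (\<Sum>j\<in>UNIV. f (Inr j))"
  unfolding UNIV_Plus_UNIV[symmetric] by (subst sum.Plus) auto

lemma inner_matrix_vector_sum:
  fixes A :: "real ^ 'n::finite ^ 'm::finite"
  shows "x \<bullet> (A *v y) = (\<Sum>i\<in>UNIV. \<Sum>j\<in>UNIV. A $ i $ j * x $ i * y $ j)"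
  by (simp add: inner_vec_def matrix_vector_mult_def sum_distrib_left mult_ac)

lemma inner_block_matrix:
  fixes A :: "real ^ 'r::finite ^ 'r" and D :: "real ^ 's::finite ^ 's"
  assumes "x = (\<chi> k. case k of Inl i \<Rightarrow> p $ i | Inr j \<Rightarrow> q $ j)"
  shows "x \<bullet> (block_matrix A B C D *v x)
    = p \<bullet> (A *v p) + p \<bullet> (B *v q) + q \<bullet> (C *v p) + q \<bullet> (D *v q)"
  by (simp add: assms inner_matrix_vector_sum sum_UNIV_Plus block_matrix_def sum.distrib)

lemma inner_transpose_matrix_mult:
  fixes A :: "real ^ 'n::finite ^ 'k::finite" and B :: "real ^ 'm::finite ^ 'k"
  shows "x \<bullet> ((transpose A ** B) *v y) = (A *v x) \<bullet> (B *v y)"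
  by (metis dot_lmul_matrix matrix_vector_mul_assoc vector_transpose_matrix)

text \<open>
  The blocks of the stability matrix are what remains of the right-hand side after
  substituting the stage and update equations; the factor 2 collects the two copies of \<open>H\<close>,
  which coincide as scalars because \<open>H\<close> is symmetric.
\<close>

lemma stability_matrix_quadratic_form:
  fixes D11 :: "real ^ 's::finite ^ 's" and D22 :: "real ^ 'r::finite ^ 'r"
  assumes "x = (\<chi> k. case k of Inl i \<Rightarrow> p $ i | Inr j \<Rightarrow> q $ j)"
    and "diagonal_matrix H"
    and "U = D11 *v q + D12 *v p" and "p' = D21 *v q + D22 *v p"
  shows "x \<bullet> (stability_matrix D11 D12 D21 D22 G H *v x)
    = p \<bullet> (G *v p) - p' \<bullet> (G *v p') + 2 * (q \<bullet> (H *v U))"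
proof -
  have H: "transpose H = H"
    using assms(2) by (auto simp: diagonal_matrix_def transpose_def vec_eq_iff) metis
  have comm: "(A *v y) \<bullet> (H *v q) = q \<bullet> (H *v (A *v y))" for A :: "real ^ 'k::finite ^ 's" and y
    using inner_transpose_matrix_mult[of q H "mat 1" "A *v y"] H by (simp add: inner_commute)
  show ?thesis
    unfolding stability_matrix_def inner_block_matrix[OF assms(1)] assms(3,4)
    by (simp add: matrix_vector_mult_diff_rdistrib matrix_vector_mult_add_rdistrib
        matrix_vector_right_distrib inner_add inner_diff_right inner_transpose_matrix_mult
        flip: matrix_mul_assoc)
      (simp add: comm matrix_vector_right_distrib inner_add flip: matrix_vector_mul_assoc)
qed

text \<open>
  The estimate is \<open>x \<bullet> M x \<ge> 0\<close> at the vector \<open>x\<close> that consists of \<open>u\<close> and \<open>\<tau> K\<close>.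
  The weights \<open>h\<close> depend only on the method: the same ones must serve all the coordinates of
  \<open>u\<close> and the auxiliary variable, which is why they are obtained before the step is chosen.
\<close>

lemma algebraically_stable_scalar:
  fixes D11 :: "real ^ 's::finite ^ 's" and D22 :: "real ^ 'r::finite ^ 'r"
  assumes "algebraically_stable_with D11 D12 D21 D22 G"
  obtains h :: "'s \<Rightarrow> real" where "\<And>i. 0 \<le> h i"
    and "\<And>\<tau> u U K u'. GLTD_step D11 D12 D21 D22 \<tau> u U K u' \<Longrightarrow>
      (\<Sum>i\<in>UNIV. \<Sum>j\<in>UNIV. G $ i $ j * u' i * u' j)
      \<le> (\<Sum>i\<in>UNIV. \<Sum>j\<in>UNIV. G $ i $ j * u i * u j) + 2 * \<tau> * (\<Sum>i\<in>UNIV. h i * (U i * K i))"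
proof -
  obtain H where H: "diagonal_matrix H" "nonneg_definite H"
    "nonneg_definite (stability_matrix D11 D12 D21 D22 G H)"
    using assms by (auto simp: algebraically_stable_with_def)
  have "0 \<le> H $ i $ i" for i
    using H(2)[unfolded nonneg_definite_def, rule_format, of "axis i 1"]
    by (simp add: inner_axis' matrix_vector_mul_component) (simp add: inner_axis)
  moreover have "(\<Sum>i\<in>UNIV. \<Sum>j\<in>UNIV. G $ i $ j * u' i * u' j)
      \<le> (\<Sum>i\<in>UNIV. \<Sum>j\<in>UNIV. G $ i $ j * u i * u j) + 2 * \<tau> * (\<Sum>i\<in>UNIV. H $ i $ i * (U i * K i))"
    if step: "GLTD_step D11 D12 D21 D22 \<tau> u U K u'" for \<tau> u U K u'
  proof -
    define p q p' Uv where "p = (\<chi> i. u i)" and "q = (\<chi> i. \<tau> * K i)"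
      and "p' = (\<chi> i. u' i)" and "Uv = (\<chi> i. U i)"
    note defs = p_def q_def p'_def Uv_def
    define x where "x = (\<chi> k. case k of Inl i \<Rightarrow> p $ i | Inr j \<Rightarrow> q $ j)"
    have stage: "Uv = D11 *v q + D12 *v p" and update: "p' = D21 *v q + D22 *v p"
      using step by (simp_all add: GLTD_step_def defs vec_eq_iff matrix_vector_mult_def sum_distrib_left mult_ac)
    have diag: "q \<bullet> (H *v Uv) = (\<Sum>i\<in>UNIV. H $ i $ i * q $ i * Uv $ i)"
    proof -
      have "(\<Sum>j\<in>UNIV. H $ i $ j * q $ i * Uv $ j)
        = (\<Sum>j\<in>UNIV. if j = i then H $ i $ i * q $ i * Uv $ i else 0)" for i
        using H(1) by (intro sum.cong) (auto simp: diagonal_matrix_def)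
      then show ?thesis by (simp add: inner_matrix_vector_sum)
    qed
    have "0 \<le> p \<bullet> (G *v p) - p' \<bullet> (G *v p') + 2 * (q \<bullet> (H *v Uv))"
      using H(3) stability_matrix_quadratic_form[OF x_def H(1) stage update, of G]
      by (metis nonneg_definite_def)
    then show ?thesis
      unfolding diag unfolding inner_matrix_vector_sum by (simp add: defs sum_distrib_left mult_ac)
  qed
  ultimately show ?thesis by (rule that)
qed


section \<open>Energy forms on \<open>L\<^sup>2(\<Omega>)\<close>\<close>

lemma L2_mult_integrable:
  assumes "f \<in> L2 \<Omega>" "g \<in> L2 \<Omega>"
  shows "integrable (lebesgue_on \<Omega>) (\<lambda>x. f x * g x)"
proof (rule Bochner_Integration.integrable_bound)
  show "integrable (lebesgue_on \<Omega>) (\<lambda>x. (f x)\<^sup>2 + (g x)\<^sup>2)"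
    using assms by (simp add: L2_def)
  show "(\<lambda>x. f x * g x) \<in> borel_measurable (lebesgue_on \<Omega>)"
    using assms by (auto simp: L2_def)
  have "\<bar>a * b\<bar> \<le> a\<^sup>2 + b\<^sup>2" for a b :: real
  proof -
    have "2 * (\<bar>a\<bar> * \<bar>b\<bar>) \<le> \<bar>a\<bar>\<^sup>2 + \<bar>b\<bar>\<^sup>2"
      using sum_squares_bound[of "\<bar>a\<bar>" "\<bar>b\<bar>"] by simp
    moreover have "0 \<le> \<bar>a\<bar> * \<bar>b\<bar>" by simp
    ultimately show ?thesis unfolding abs_mult power2_abs by linarith
  qed
  then show "AE x in lebesgue_on \<Omega>. norm (f x * g x) \<le> norm ((f x)\<^sup>2 + (g x)\<^sup>2)"
    by simp
qed

lemma L2_inner_commute: "L2_inner \<Omega> f g = L2_inner \<Omega> g f"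
  by (simp add: L2_inner_def mult.commute)

lemma L2_inner_cong:
  assumes "f \<in> L2 \<Omega>" "g \<in> L2 \<Omega>" "g' \<in> L2 \<Omega>" "eq_on_ae \<Omega> g g'"
  shows "L2_inner \<Omega> f g = L2_inner \<Omega> f g'"
  unfolding L2_inner_def
proof (rule integral_cong_AE)
  show "AE x in lebesgue_on \<Omega>. f x * g x = f x * g' x"
    using assms(4) unfolding eq_on_ae_def by eventually_elim simp
qed (use assms in \<open>auto simp: L2_def\<close>)

lemma L2_inner_sum_right:
  assumes "f \<in> L2 \<Omega>" "\<And>k. k \<in> S \<Longrightarrow> w k \<in> L2 \<Omega>"
  shows "L2_inner \<Omega> f (\<lambda>x. \<Sum>k\<in>S. c k * w k x) = (\<Sum>k\<in>S. c k * L2_inner \<Omega> f (w k))"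
proof -
  have "L2_inner \<Omega> f (\<lambda>x. \<Sum>k\<in>S. c k * w k x) = (LINT x|lebesgue_on \<Omega>. (\<Sum>k\<in>S. c k * (f x * w k x)))"
    by (simp add: L2_inner_def sum_distrib_left mult_ac)
  also have "\<dots> = (\<Sum>k\<in>S. (LINT x|lebesgue_on \<Omega>. c k * (f x * w k x)))"
    by (rule Bochner_Integration.integral_sum) (simp add: L2_mult_integrable assms)
  finally show ?thesis by (simp add: L2_inner_def)
qed

lemma L2_subspace_sum:
  assumes "L2_subspace \<Omega> V" "finite S" "\<And>k. k \<in> S \<Longrightarrow> w k \<in> V"
  shows "(\<lambda>x. \<Sum>k\<in>S. c k * w k x) \<in> V"
  using assms(2,3)
proof (induction S rule: finite_induct)
  case empty
  then show ?case using assms(1) by (simp add: L2_subspace_def)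
next
  case (insert a S)
  moreover have scale: "\<And>c v. v \<in> V \<Longrightarrow> (\<lambda>x. c * v x) \<in> V"
    and add: "\<And>v w. v \<in> V \<Longrightarrow> w \<in> V \<Longrightarrow> (\<lambda>x. v x + w x) \<in> V"
    using assms(1) by (simp_all add: L2_subspace_def)
  ultimately have "(\<lambda>x. c a * w a x) \<in> V" "(\<lambda>x. \<Sum>k\<in>S. c k * w k x) \<in> V"
    by simp_all
  from add[OF this] show ?case using insert.hyps by simp
qed

lemma energy_form_commute:
  assumes "symmetric_operator \<Omega> V A" "v \<in> V" "w \<in> V"
  shows "L2_inner \<Omega> (A v) w = L2_inner \<Omega> (A w) v"
  using assms by (metis L2_inner_commute symmetric_operator_def)

text \<open>
  Linearity of the \<open>L\<^sup>2\<close> inner product expands the second argument of \<open>(A v, v)\<close>; symmetry of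
  \<open>A\<close> exchanges the arguments, so the first one is expanded in the same way.
\<close>

lemma energy_form_lincomb:
  fixes w :: "'k::finite \<Rightarrow> 'a::euclidean_space \<Rightarrow> real"
    and c :: "'k \<Rightarrow> real"
  assumes A: "linear_operator \<Omega> V A" "symmetric_operator \<Omega> V A" and w: "\<And>k. w k \<in> V"
  defines "v \<equiv> \<lambda>x. \<Sum>k\<in>UNIV. c k * w k x"
  shows "v \<in> V"
    and "(\<Sum>k\<in>UNIV. \<Sum>l\<in>UNIV. c k * c l * L2_inner \<Omega> (A (w k)) (w l)) = L2_inner \<Omega> (A v) v"
proof -
  have V: "L2_subspace \<Omega> V" "V \<subseteq> L2 \<Omega>" "A ` V \<subseteq> L2 \<Omega>"
    using A(1) by (auto simp: linear_operator_def L2_subspace_def)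
  show v: "v \<in> V"
    unfolding v_def by (rule L2_subspace_sum[OF V(1)]) (simp_all add: w)
  have right: "L2_inner \<Omega> (A y) v = (\<Sum>l\<in>UNIV. c l * L2_inner \<Omega> (A y) (w l))" if "y \<in> V" for y
    unfolding v_def by (rule L2_inner_sum_right) (use V w that in auto)
  have "L2_inner \<Omega> (A v) v = (\<Sum>k\<in>UNIV. c k * L2_inner \<Omega> (A (w k)) v)"
    by (simp add: right v energy_form_commute[OF A(2) v w])
  also have "\<dots> = (\<Sum>k\<in>UNIV. \<Sum>l\<in>UNIV. c k * c l * L2_inner \<Omega> (A (w k)) (w l))"
    by (simp add: right w sum_distrib_left mult_ac)
  finally show "(\<Sum>k\<in>UNIV. \<Sum>l\<in>UNIV. c k * c l * L2_inner \<Omega> (A (w k)) (w l)) = L2_inner \<Omega> (A v) v"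
    by simp
qed

text \<open>
  This reduces statements about finitely many elements of a function space to scalars, since
  every linear relation that holds almost everywhere also holds in each coordinate.
\<close>

lemma energy_form_gram_coordinates:
  fixes w :: "'k::finite \<Rightarrow> 'a::euclidean_space \<Rightarrow> real"
  assumes A: "linear_operator \<Omega> V A" "symmetric_operator \<Omega> V A" "nonneg_operator \<Omega> V A"
    and w: "\<And>k. w k \<in> V"
  obtains m :: nat and c
  where "\<And>k l. L2_inner \<Omega> (A (w k)) (w l) = (\<Sum>p<m. c p k * c p l)"
    and "\<And>x p. eq_on_ae \<Omega> (\<lambda>y. \<Sum>k\<in>UNIV. x k * w k y) (\<lambda>y. 0) \<Longrightarrow> p < m \<Longrightarrow>
          (\<Sum>k\<in>UNIV. x k * c p k) = 0"
proof -
  let ?b = "\<lambda>k l. L2_inner \<Omega> (A (w k)) (w l)"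
  have psd: "0 \<le> (\<Sum>k\<in>UNIV. \<Sum>l\<in>UNIV. x k * x l * ?b k l)" for x
    unfolding energy_form_lincomb(2)[OF A(1,2) w]
    using A(3) energy_form_lincomb(1)[OF A(1,2) w] unfolding nonneg_operator_def by (rule bspec)
  obtain m c where c: "\<And>k l. ?b k l = (\<Sum>p<m::nat. c p k * c p l)"
    and rel: "\<And>x p. (\<Sum>k\<in>UNIV. \<Sum>l\<in>UNIV. x k * x l * ?b k l) = 0 \<Longrightarrow> p < m \<Longrightarrow>
          (\<Sum>k\<in>UNIV. x k * c p k) = 0"
    by (rule psd_gram_coordinates[of ?b, OF energy_form_commute[OF A(2) w w] psd]) blast
  have "(\<Sum>k\<in>UNIV. \<Sum>l\<in>UNIV. x k * x l * ?b k l) = 0"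
    if "eq_on_ae \<Omega> (\<lambda>y. \<Sum>k\<in>UNIV. x k * w k y) (\<lambda>y. 0)" for x
  proof -
    let ?v = "\<lambda>y. \<Sum>k\<in>UNIV. x k * w k y"
    have v: "?v \<in> V" by (rule energy_form_lincomb(1)[OF A(1,2), of w, OF w])
    have "L2_inner \<Omega> (A ?v) ?v = L2_inner \<Omega> (A ?v) (\<lambda>y. 0)"
      by (rule L2_inner_cong) (use A(1) v that in \<open>auto simp: linear_operator_def L2_subspace_def\<close>)
    then show ?thesis
      unfolding energy_form_lincomb(2)[OF A(1,2) w] by (simp add: L2_inner_def)
  qed
  then show ?thesis by (intro that[OF c] rel)
qed


section \<open>The energy estimate\<close>

text \<open>
  The functions \<open>u\<close>, \<open>K\<close>, \<open>U\<close>, \<open>u'\<close> of one step are treated as a single family, so that the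
  stage and update equations become linear relations between its members and therefore
  hold for the scalar coordinates as well.
\<close>

lemma GLTD_energy_estimate:
  fixes D11 :: "real ^ 's::finite ^ 's" and D22 G :: "real ^ 'r::finite ^ 'r"
    and \<Omega> :: "'a::euclidean_space set"
  assumes scalar: "\<And>u U K u'. GLTD_step D11 D12 D21 D22 \<tau> u U K u' \<Longrightarrow>
      (\<Sum>i\<in>UNIV. \<Sum>j\<in>UNIV. G $ i $ j * u' i * u' j)
      \<le> (\<Sum>i\<in>UNIV. \<Sum>j\<in>UNIV. G $ i $ j * u i * u j) + 2 * \<tau> * (\<Sum>i\<in>UNIV. h i * (U i * K i))"
    and A: "linear_operator \<Omega> V A" "symmetric_operator \<Omega> V A" "nonneg_operator \<Omega> V A"
    and mem: "\<And>i. u i \<in> V" "\<And>i. U i \<in> V" "\<And>i. K i \<in> V" "\<And>i. u' i \<in> V"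
    and step: "AE x in lebesgue_on \<Omega>.
      GLTD_step D11 D12 D21 D22 \<tau> (\<lambda>i. u i x) (\<lambda>i. U i x) (\<lambda>i. K i x) (\<lambda>i. u' i x)"
  shows "G_form \<Omega> A G u' u' \<le> G_form \<Omega> A G u u + 2 * \<tau> * (\<Sum>i\<in>UNIV. h i * L2_inner \<Omega> (A (U i)) (K i))"
proof -
  define w where "w = case_sum (case_sum u K) (case_sum U u')"
  have w: "w k \<in> V" for k
    using mem by (auto simp: w_def split: sum.split)
  obtain m c where c: "\<And>k l. L2_inner \<Omega> (A (w k)) (w l) = (\<Sum>p<m::nat. c p k * c p l)"
    and rel: "\<And>x p. eq_on_ae \<Omega> (\<lambda>y. \<Sum>k\<in>UNIV. x k * w k y) (\<lambda>y. 0) \<Longrightarrow> p < m \<Longrightarrow>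
          (\<Sum>k\<in>UNIV. x k * c p k) = 0"
    by (rule energy_form_gram_coordinates[OF A, of w, OF w]) blast
  define cu cK cU cu' where "cu p i = c p (Inl (Inl i))" and "cK p j = c p (Inl (Inr j))"
    and "cU p j = c p (Inr (Inl j))" and "cu' p i = c p (Inr (Inr i))" for p i j
  note coords = cu_def cK_def cU_def cu'_def
  have step_coords: "GLTD_step D11 D12 D21 D22 \<tau> (cu p) (cU p) (cK p) (cu' p)" if p: "p < m" for p
    unfolding GLTD_step_def
  proof (intro conjI allI)
    fix i
    \<comment> \<open>coefficients of the \<open>i\<close>-th stage equation, brought to one side\<close>
    define x where "x = case_sum (case_sum (\<lambda>j. - D12 $ i $ j) (\<lambda>j. - \<tau> * D11 $ i $ j))
      (case_sum (\<lambda>j. if j = i then 1 else 0) (\<lambda>j::'r. 0))"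
    have expand: "(\<Sum>k\<in>UNIV. x k * f k) = f (Inr (Inl i))
        - \<tau> * (\<Sum>j\<in>UNIV. D11 $ i $ j * f (Inl (Inr j))) - (\<Sum>j\<in>UNIV. D12 $ i $ j * f (Inl (Inl j)))" for f
      by (simp add: x_def sum_UNIV_Plus sum_negf sum_distrib_left mult.assoc
          if_distrib[of "\<lambda>y. y * _"] cong: if_cong)
    have null: "eq_on_ae \<Omega> (\<lambda>y. \<Sum>k\<in>UNIV. x k * w k y) (\<lambda>y. 0)"
      unfolding eq_on_ae_def using step
      by eventually_elim (simp add: expand w_def GLTD_step_def)
    show "cU p i = \<tau> * (\<Sum>j\<in>UNIV. D11 $ i $ j * cK p j) + (\<Sum>j\<in>UNIV. D12 $ i $ j * cu p j)"
      using rel[OF null p] unfolding expand coords by simp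
  next
    fix i
    \<comment> \<open>coefficients of the \<open>i\<close>-th update equation\<close>
    define x where "x = case_sum (case_sum (\<lambda>j. - D22 $ i $ j) (\<lambda>j. - \<tau> * D21 $ i $ j))
      (case_sum (\<lambda>j::'s. 0) (\<lambda>j. if j = i then 1 else 0))"
    have expand: "(\<Sum>k\<in>UNIV. x k * f k) = f (Inr (Inr i))
        - \<tau> * (\<Sum>j\<in>UNIV. D21 $ i $ j * f (Inl (Inr j))) - (\<Sum>j\<in>UNIV. D22 $ i $ j * f (Inl (Inl j)))" for f
      by (simp add: x_def sum_UNIV_Plus sum_negf sum_distrib_left mult.assoc
          if_distrib[of "\<lambda>y. y * _"] cong: if_cong)
    have null: "eq_on_ae \<Omega> (\<lambda>y. \<Sum>k\<in>UNIV. x k * w k y) (\<lambda>y. 0)"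
      unfolding eq_on_ae_def using step
      by eventually_elim (simp add: expand w_def GLTD_step_def)
    show "cu' p i = \<tau> * (\<Sum>j\<in>UNIV. D21 $ i $ j * cK p j) + (\<Sum>j\<in>UNIV. D22 $ i $ j * cu p j)"
      using rel[OF null p] unfolding expand coords by simp
  qed
  have form: "G_form \<Omega> A G v v = (\<Sum>p<m. \<Sum>i\<in>UNIV. \<Sum>j\<in>UNIV. G $ i $ j * c p (\<iota> i) * c p (\<iota> j))"
    if "v = (\<lambda>i. w (\<iota> i))" for v \<iota>
  proof -
    have "G_form \<Omega> A G v v = (\<Sum>i\<in>UNIV. \<Sum>j\<in>UNIV. \<Sum>p<m. G $ i $ j * c p (\<iota> i) * c p (\<iota> j))"
      by (simp add: G_form_def that c sum_distrib_left mult.assoc)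
    also have "\<dots> = (\<Sum>i\<in>UNIV. \<Sum>p<m. \<Sum>j\<in>UNIV. G $ i $ j * c p (\<iota> i) * c p (\<iota> j))"
      by (intro sum.cong refl sum.swap)
    finally show ?thesis by (simp only: sum.swap[of _ "{..<m}"])
  qed
  have pairing: "(\<Sum>i\<in>UNIV. h i * L2_inner \<Omega> (A (U i)) (K i)) = (\<Sum>p<m. \<Sum>i\<in>UNIV. h i * (cU p i * cK p i))"
  proof -
    have "L2_inner \<Omega> (A (U i)) (K i) = (\<Sum>p<m. cU p i * cK p i)" for i
      using c[of "Inr (Inl i)" "Inl (Inr i)"] by (simp add: w_def coords)
    then have "(\<Sum>i\<in>UNIV. h i * L2_inner \<Omega> (A (U i)) (K i)) = (\<Sum>i\<in>UNIV. \<Sum>p<m. h i * (cU p i * cK p i))"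
      by (simp add: sum_distrib_left)
    then show ?thesis by (simp only: sum.swap[of _ "{..<m}"])
  qed
  have "(\<Sum>p<m. \<Sum>i\<in>UNIV. \<Sum>j\<in>UNIV. G $ i $ j * cu' p i * cu' p j)
      \<le> (\<Sum>p<m. (\<Sum>i\<in>UNIV. \<Sum>j\<in>UNIV. G $ i $ j * cu p i * cu p j)
          + 2 * \<tau> * (\<Sum>i\<in>UNIV. h i * (cU p i * cK p i)))"
    using scalar[OF step_coords] by (intro sum_mono) auto
  moreover have "u = (\<lambda>i. w (Inl (Inl i)))" "u' = (\<lambda>i. w (Inr (Inr i)))"
    by (simp_all add: w_def)
  ultimately show ?thesis
    unfolding pairing by (simp add: form coords sum.distrib sum_distrib_left)
qed

text \<open>
  Twice the left-hand side is \<open>(\<L> U\<^sub>i + Z\<^sub>i W(Ubar\<^sub>i), \<G> \<mu>\<^sub>i) = (\<mu>\<^sub>i, \<G> \<mu>\<^sub>i)\<close>,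
  which is non-positive since \<open>\<G>\<close> is.
\<close>

lemma SAV_GL_dissipation:
  assumes step: "SAV_GL_step \<Omega> V \<L> V\<^sub>G \<G> W D11 D12 D21 D22 \<tau> Ubar u z U Z Udot Zdot \<mu> u' z'"
    and \<L>: "linear_operator \<Omega> V \<L>"
    and \<G>: "linear_operator \<Omega> V\<^sub>G \<G>" "nonpos_operator \<Omega> V\<^sub>G \<G>"
    and W: "W (Ubar i) \<in> L2 \<Omega>"
  shows "1 / 2 * L2_inner \<Omega> (\<L> (U i)) (Udot i) + Z i * Zdot i \<le> 0"
proof -
  have mem: "U i \<in> V" "Udot i \<in> V" "\<mu> i \<in> V\<^sub>G"
    and flow: "eq_on_ae \<Omega> (Udot i) (\<G> (\<mu> i))"
    and potential: "eq_on_ae \<Omega> (\<mu> i) (\<lambda>x. \<L> (U i) x + Z i * W (Ubar i) x)"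
    and Zdot: "Zdot i = 1 / 2 * L2_inner \<Omega> (W (Ubar i)) (Udot i)"
    using step unfolding SAV_GL_step_def by auto
  have L2: "\<L> (U i) \<in> L2 \<Omega>" "Udot i \<in> L2 \<Omega>" "\<mu> i \<in> L2 \<Omega>" "\<G> (\<mu> i) \<in> L2 \<Omega>"
    using mem \<L> \<G>(1) by (auto simp: linear_operator_def L2_subspace_def)
  have "L2_inner \<Omega> (\<L> (U i)) (Udot i) + Z i * L2_inner \<Omega> (W (Ubar i)) (Udot i)
      = (LINT x|lebesgue_on \<Omega>. (\<L> (U i) x + Z i * W (Ubar i) x) * Udot i x)"
    using L2_mult_integrable[OF L2(1,2)] L2_mult_integrable[OF W L2(2)]
    by (simp add: L2_inner_def distrib_right mult.assoc)
  also have "\<dots> = L2_inner \<Omega> (\<mu> i) (\<G> (\<mu> i))"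
    unfolding L2_inner_def
  proof (rule integral_cong_AE)
    show "AE x in lebesgue_on \<Omega>. (\<L> (U i) x + Z i * W (Ubar i) x) * Udot i x = \<mu> i x * \<G> (\<mu> i) x"
      using flow potential unfolding eq_on_ae_def by eventually_elim simp
  qed (use L2 W in \<open>auto simp: L2_def\<close>)
  also have "\<dots> \<le> 0"
    using \<G>(2) mem by (auto simp: nonpos_operator_def)
  finally show ?thesis by (simp add: Zdot algebra_simps)
qed

lemma SAV_W_in_L2:
  assumes "SAV_energy \<Omega> V F dF1 C0" "v \<in> V"
  shows "SAV_W \<Omega> F dF1 C0 v \<in> L2 \<Omega>"
  using assms
  by (auto simp: SAV_energy_def has_variational_derivative_def L2_def SAV_W_def power_divide)

lemma G_norm_power2:
  assumes "sym_pos_definite G"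
  shows "(G_norm G \<sigma>)\<^sup>2 = (\<Sum>i\<in>UNIV. \<Sum>j\<in>UNIV. G $ i $ j * \<sigma> i * \<sigma> j)"
proof -
  have "0 \<le> x \<bullet> (G *v x)" for x
    using assms by (cases "x = 0") (auto simp: sym_pos_definite_def intro: less_imp_le)
  from this[of "\<chi> i. \<sigma> i"] show ?thesis
    by (simp add: G_norm_def inner_matrix_vector_sum)
qed

theorem theorem3p1:
  fixes \<Omega> :: "'a::euclidean_space set"
    and V V\<^sub>G :: "('a \<Rightarrow> real) set"
    and \<L> \<G> dF1 :: "('a \<Rightarrow> real) \<Rightarrow> ('a \<Rightarrow> real)"
    and F :: "real \<Rightarrow> real"
    and C0 \<tau> :: real
    and D11 :: "real ^ 's::finite ^ 's"
    and D12 :: "real ^ 'r::finite ^ 's"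
    and D21 :: "real ^ 's ^ 'r"
    and D22 G :: "real ^ 'r ^ 'r"
    and Ubar U Udot \<mu> :: "'s \<Rightarrow> 'a \<Rightarrow> real"
    and Z Zdot :: "'s \<Rightarrow> real"
    and u u' :: "'r \<Rightarrow> 'a \<Rightarrow> real"
    and z z' :: "'r \<Rightarrow> real"
  assumes "domain_set \<Omega>" and "bounded \<Omega>"
    and "linear_operator \<Omega> V \<L>" and "symmetric_operator \<Omega> V \<L>" and "nonneg_operator \<Omega> V \<L>"
    and "linear_operator \<Omega> V\<^sub>G \<G>" and "symmetric_operator \<Omega> V\<^sub>G \<G>" and "nonpos_operator \<Omega> V\<^sub>G \<G>"
    and "SAV_energy \<Omega> V F dF1 C0"
    and "0 < \<tau>"
    and "algebraically_stable_with D11 D12 D21 D22 G"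
    and "SAV_GL_step \<Omega> V \<L> V\<^sub>G \<G> (SAV_W \<Omega> F dF1 C0) D11 D12 D21 D22 \<tau>
           Ubar u z U Z Udot Zdot \<mu> u' z'"
  shows "1 / 2 * G_form \<Omega> \<L> G u' u' + (G_norm G z')\<^sup>2
       \<le> 1 / 2 * G_form \<Omega> \<L> G u u + (G_norm G z)\<^sup>2"
proof -
  note \<L> = assms(3-5) and step = assms(12)
  obtain h :: "'s \<Rightarrow> real" where h: "\<And>i. 0 \<le> h i"
    and scalar: "\<And>\<tau> u U K u'. GLTD_step D11 D12 D21 D22 \<tau> u U K u' \<Longrightarrow>
      (\<Sum>i\<in>UNIV. \<Sum>j\<in>UNIV. G $ i $ j * u' i * u' j)
      \<le> (\<Sum>i\<in>UNIV. \<Sum>j\<in>UNIV. G $ i $ j * u i * u j) + 2 * \<tau> * (\<Sum>i\<in>UNIV. h i * (U i * K i))"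
    using algebraically_stable_scalar[OF assms(11)] by blast
  have energy_u: "G_form \<Omega> \<L> G u' u'
      \<le> G_form \<Omega> \<L> G u u + 2 * \<tau> * (\<Sum>i\<in>UNIV. h i * L2_inner \<Omega> (\<L> (U i)) (Udot i))"
    by (rule GLTD_energy_estimate[OF scalar \<L>]) (use step in \<open>auto simp: SAV_GL_step_def\<close>)
  have energy_z: "(\<Sum>i\<in>UNIV. \<Sum>j\<in>UNIV. G $ i $ j * z' i * z' j)
      \<le> (\<Sum>i\<in>UNIV. \<Sum>j\<in>UNIV. G $ i $ j * z i * z j) + 2 * \<tau> * (\<Sum>i\<in>UNIV. h i * (Z i * Zdot i))"
    by (rule scalar) (use step in \<open>auto simp: SAV_GL_step_def\<close>)
  have "1 / 2 * L2_inner \<Omega> (\<L> (U i)) (Udot i) + Z i * Zdot i \<le> 0" for i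
    by (rule SAV_GL_dissipation[OF step \<L>(1) assms(6,8) SAV_W_in_L2[OF assms(9)]])
      (use step in \<open>auto simp: SAV_GL_step_def\<close>)
  then have "(\<Sum>i\<in>UNIV. h i * (1 / 2 * L2_inner \<Omega> (\<L> (U i)) (Udot i) + Z i * Zdot i)) \<le> 0"
    using h by (intro sum_nonpos mult_nonneg_nonpos) auto
  then have "2 * \<tau> * (\<Sum>i\<in>UNIV. h i * (1 / 2 * L2_inner \<Omega> (\<L> (U i)) (Udot i) + Z i * Zdot i)) \<le> 0"
    using \<open>0 < \<tau>\<close> by (intro mult_nonneg_nonpos) auto
  also have "2 * \<tau> * (\<Sum>i\<in>UNIV. h i * (1 / 2 * L2_inner \<Omega> (\<L> (U i)) (Udot i) + Z i * Zdot i))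
      = 1 / 2 * (2 * \<tau> * (\<Sum>i\<in>UNIV. h i * L2_inner \<Omega> (\<L> (U i)) (Udot i)))
        + 2 * \<tau> * (\<Sum>i\<in>UNIV. h i * (Z i * Zdot i))"
    by (simp add: sum.distrib sum_distrib_left algebra_simps)
  finally show ?thesis
    using energy_u energy_z assms(11)
    by (simp add: G_norm_power2 algebraically_stable_with_def)
qed

end
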